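(* Let $\delta > 2$ be an integer and let $G$ be a connected $\delta$-regular graph with girth at least $5$. Then $G$ is not containable.
   Context: Graphs are finite, simple and undirected. Containment: on a connected graph $G$, some number of cops are first placed on edges of $G$ (several cops may share an edge), then the robber chooses a vertex. They then alternate turns, cops first, with full information. On the cops' turn each cop stays put or moves to an adjacent edge (an edge sharing an endpoint with her current edge; moving through a vertex occupied by the robber is allowed). On the robber's turn he stays put or moves to an adjacent vertex along an edge not currently occupied by a cop. The cops win (contain the robber) if at some time it is the robber's turn and every edge incident with the robber's vertex is occupied by at least one cop. A connected graph $G$ is called containable if $\Delta(G)$ cops (where $\Delta(G)$ is the maximum degree) have a strategy guaranteeing a win on $G$. *)

theory Defs
  imports Main "HOL-Library.Extended_Nat"
begin

text \<open>A graph is given by its vertex set \<open>V\<close> and its set \<open>E\<close> of edges, an edge being the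
  two-element set of its endpoints.\<close>

definition finite_simple_graph :: "'a set \<Rightarrow> 'a set set \<Rightarrow> bool" where
  "finite_simple_graph V E \<longleftrightarrow> finite V \<and> (\<forall>e\<in>E. e \<subseteq> V \<and> card e = 2)"

text \<open>The graph without vertices does not count as connected.\<close>

definition connected_graph :: "'a set \<Rightarrow> 'a set set \<Rightarrow> bool" where
  "connected_graph V E \<longleftrightarrow>
     V \<noteq> {} \<and> (\<forall>u\<in>V. \<forall>v\<in>V. (u, v) \<in> {(x, y). {x, y} \<in> E}\<^sup>*)"

definition incident_edges :: "'a set set \<Rightarrow> 'a \<Rightarrow> 'a set set" where
  "incident_edges E v = {e \<in> E. v \<in> e}"

definition degree :: "'a set set \<Rightarrow> 'a \<Rightarrow> nat" where
  "degree E v = card (incident_edges E v)"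

definition regular_graph :: "'a set \<Rightarrow> 'a set set \<Rightarrow> nat \<Rightarrow> bool" where
  "regular_graph V E d \<longleftrightarrow> (\<forall>v\<in>V. degree E v = d)"

definition max_degree :: "'a set \<Rightarrow> 'a set set \<Rightarrow> nat" where
  "max_degree V E = Max (degree E ` V)"

text \<open>A cycle is listed by its vertices in cyclic order, without repeating the first one at the
  end, so that the length of the list is the length of the cycle.\<close>

definition is_cycle :: "'a set set \<Rightarrow> 'a list \<Rightarrow> bool" where
  "is_cycle E vs \<longleftrightarrow> 3 \<le> length vs \<and> distinct vs \<and>
     (\<forall>i<length vs. {vs ! i, vs ! (Suc i mod length vs)} \<in> E)"

text \<open>The girth of an acyclic graph is \<open>\<infinity>\<close>, the infimum of the empty set.\<close>

definition girth :: "'a set set \<Rightarrow> enat" where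
  "girth E = (INF vs \<in> {vs. is_cycle E vs}. enat (length vs))"

text \<open>The \<open>k\<close> cops are numbered \<open>0, \<dots>, k - 1\<close>, and a placement \<open>p\<close> maps each of these numbers
  to the edge on which that cop stands; its values at other numbers are irrelevant.

  A strategy of the cops maps the list of all vertices occupied by the robber so far (oldest
  first, one entry for his initial choice and one for each of his turns) to the placement that
  the cops take up next; its value at the empty list is the initial placement. As the
  earlier placements are determined by the strategy itself, this is the full history of the game.\<close>

type_synonym 'a placement = "nat \<Rightarrow> 'a set"
type_synonym 'a strategy = "'a list \<Rightarrow> 'a placement"

definition occupied :: "nat \<Rightarrow> 'a placement \<Rightarrow> 'a set set" where
  "occupied k p = p ` {..<k}"

text \<open>A play is described by the sequence \<open>r\<close> of robber positions: \<open>r 0\<close> is his initial choice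
  and \<open>r (Suc n)\<close> his position after his \<open>n\<close>-th turn, counting from \<open>0\<close>. The
  placement after \<open>n\<close> turns of the cops is \<open>cops_at \<sigma> r n\<close>. As the cops move first, the
  robber at \<open>r n\<close> takes his \<open>n\<close>-th turn against the placement \<open>cops_at \<sigma> r (Suc n)\<close>. Plays
  are continued indefinitely, also after the robber has been contained; this is harmless since
  both sides may always stay put.\<close>

definition cops_at :: "'a strategy \<Rightarrow> (nat \<Rightarrow> 'a) \<Rightarrow> nat \<Rightarrow> 'a placement" where
  "cops_at \<sigma> r n = \<sigma> (map r [0..<n])"

definition legal_cop_step :: "'a set set \<Rightarrow> 'a set \<Rightarrow> 'a set \<Rightarrow> bool" where
  "legal_cop_step E e e' \<longleftrightarrow> e' = e \<or> e' \<in> E \<and> e \<inter> e' \<noteq> {}"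

definition legal_robber_step :: "'a set set \<Rightarrow> nat \<Rightarrow> 'a placement \<Rightarrow> 'a \<Rightarrow> 'a \<Rightarrow> bool" where
  "legal_robber_step E k p v v' \<longleftrightarrow> v' = v \<or> {v, v'} \<in> E \<and> {v, v'} \<notin> occupied k p"

definition legal_cops :: "'a set set \<Rightarrow> nat \<Rightarrow> 'a strategy \<Rightarrow> (nat \<Rightarrow> 'a) \<Rightarrow> bool" where
  "legal_cops E k \<sigma> r \<longleftrightarrow>
     (\<forall>i<k. cops_at \<sigma> r 0 i \<in> E) \<and>
     (\<forall>n. \<forall>i<k. legal_cop_step E (cops_at \<sigma> r n i) (cops_at \<sigma> r (Suc n) i))"

definition legal_robber ::
    "'a set \<Rightarrow> 'a set set \<Rightarrow> nat \<Rightarrow> 'a strategy \<Rightarrow> (nat \<Rightarrow> 'a) \<Rightarrow> bool" where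
  "legal_robber V E k \<sigma> r \<longleftrightarrow>
     r 0 \<in> V \<and> (\<forall>n. legal_robber_step E k (cops_at \<sigma> r (Suc n)) (r n) (r (Suc n)))"

definition contained :: "'a set set \<Rightarrow> nat \<Rightarrow> 'a placement \<Rightarrow> 'a \<Rightarrow> bool" where
  "contained E k p v \<longleftrightarrow> incident_edges E v \<subseteq> occupied k p"

definition winning_strategy :: "'a set \<Rightarrow> 'a set set \<Rightarrow> nat \<Rightarrow> 'a strategy \<Rightarrow> bool" where
  "winning_strategy V E k \<sigma> \<longleftrightarrow>
     (\<forall>r. legal_robber V E k \<sigma> r \<longrightarrow>
        legal_cops E k \<sigma> r \<and> (\<exists>n. contained E k (cops_at \<sigma> r (Suc n)) (r n)))"

text \<open>Used for connected graphs only.\<close>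

definition containable :: "'a set \<Rightarrow> 'a set set \<Rightarrow> bool" where
  "containable V E \<longleftrightarrow> (\<exists>\<sigma>. winning_strategy V E (max_degree V E) \<sigma>)"

end

theory Submission
  imports Defs
begin

text \<open>The robber only ever stands on vertices at which the cops cannot contain him with their next
  move. Suppose two adjacent vertices \<open>u\<close> and \<open>v\<close> are both threatened by the \<open>\<delta>\<close> cops. Containment
  leaves no cop to spare, so every cop is near both \<open>u\<close> and \<open>v\<close>, and as there are no cycles of
  length \<open>3\<close> or \<open>4\<close>, she stands on an edge at \<open>u\<close> or at \<open>v\<close>. A cop on an edge at \<open>v\<close> other than
  \<open>uv\<close> can only move onto \<open>uv\<close> when containing at \<open>u\<close>, so there is at most one such cop, and
  symmetrically with \<open>u\<close> and \<open>v\<close> exchanged. As \<open>\<delta> > 2\<close>, some cop occupies \<open>uv\<close>. Hence a robber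
  threatened at \<open>v\<close> but not contained escapes along any unoccupied edge at \<open>v\<close>;
  and if the initial placement contains \<open>v\<close>, every neighbour of \<open>v\<close> is a safe start, since at
  least two cops stand on edges at \<open>v\<close> other than \<open>uv\<close>.\<close>

section \<open>The robber's evasive play against an arbitrary strategy\<close>

definition threatened :: "'a set set \<Rightarrow> nat \<Rightarrow> 'a placement \<Rightarrow> 'a \<Rightarrow> bool" where
  "threatened E k p v \<longleftrightarrow>
     (\<exists>p'. (\<forall>i<k. legal_cop_step E (p i) (p' i)) \<and> contained E k p' v)"

text \<open>The default \<open>v\<close> makes the step legal against every placement, so the play
  can be built before the cops are known to move legally.\<close>

definition evasive_step :: "'a set set \<Rightarrow> nat \<Rightarrow> 'a placement \<Rightarrow> 'a \<Rightarrow> 'a" where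
  "evasive_step E k p v =
     (if \<exists>u. legal_robber_step E k p v u \<and> \<not> threatened E k p u
      then SOME u. legal_robber_step E k p v u \<and> \<not> threatened E k p u else v)"

text \<open>Recursion on whole histories, because the strategy reads all earlier positions of the
  robber, not only the last one.\<close>

primrec evasive_history :: "'a set set \<Rightarrow> nat \<Rightarrow> 'a strategy \<Rightarrow> 'a \<Rightarrow> nat \<Rightarrow> 'a list" where
  "evasive_history E k \<sigma> v 0 = [v]"
| "evasive_history E k \<sigma> v (Suc n) =
     (let h = evasive_history E k \<sigma> v n in h @ [evasive_step E k (\<sigma> h) (last h)])"

definition evasive_play :: "'a set set \<Rightarrow> nat \<Rightarrow> 'a strategy \<Rightarrow> 'a \<Rightarrow> nat \<Rightarrow> 'a" where
  "evasive_play E k \<sigma> v n = last (evasive_history E k \<sigma> v n)"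

lemma evasive_step_legal: "legal_robber_step E k p v (evasive_step E k p v)"
proof (cases "\<exists>u. legal_robber_step E k p v u \<and> \<not> threatened E k p u")
  case True
  then show ?thesis
    unfolding evasive_step_def using someI_ex[OF True] by simp
next
  case False
  then have "evasive_step E k p v = v"
    unfolding evasive_step_def by (rule if_not_P)
  then show ?thesis by (simp add: legal_robber_step_def)
qed

lemma evasive_step_not_threatened:
  assumes "legal_robber_step E k p v u" "\<not> threatened E k p u"
  shows "\<not> threatened E k p (evasive_step E k p v)"
proof -
  have ex: "\<exists>u. legal_robber_step E k p v u \<and> \<not> threatened E k p u"
    using assms by blast
  then show ?thesis
    unfolding evasive_step_def using someI_ex[OF ex] by simp
qed

lemma map_evasive_play:
  "map (evasive_play E k \<sigma> v) [0..<Suc n] = evasive_history E k \<sigma> v n"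
  by (induction n) (simp_all add: evasive_play_def Let_def)

lemma evasive_play_0 [simp]: "evasive_play E k \<sigma> v 0 = v"
  by (simp add: evasive_play_def)

text \<open>The history up to index \<open>n\<close> has \<open>n + 1\<close> entries, so the cops'
  answer to it is their placement after \<open>Suc n\<close> turns, the one the robber faces in his
  turn \<open>n\<close>.\<close>

lemma evasive_play_Suc:
  "evasive_play E k \<sigma> v (Suc n) =
     evasive_step E k (cops_at \<sigma> (evasive_play E k \<sigma> v) (Suc n)) (evasive_play E k \<sigma> v n)"
  unfolding cops_at_def map_evasive_play by (simp add: evasive_play_def Let_def)

lemma legal_robber_evasive_play:
  "v \<in> V \<Longrightarrow> legal_robber V E k \<sigma> (evasive_play E k \<sigma> v)"
  by (simp add: legal_robber_def evasive_play_Suc evasive_step_legal)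

lemma not_contained_if_not_threatened:
  assumes "\<not> threatened E k p v" "\<And>i. i < k \<Longrightarrow> legal_cop_step E (p i) (p' i)"
  shows "\<not> contained E k p' v"
  using assms by (auto simp: threatened_def)

section \<open>Short cycles, containing placements and edges near an edge\<close>

lemma girth_le_length: "is_cycle E vs \<Longrightarrow> girth E \<le> enat (length vs)"
  unfolding girth_def by (rule INF_lower) simp

lemma no_triangle:
  assumes "girth E \<ge> 5" "{a, b} \<in> E" "{b, c} \<in> E" "{c, a} \<in> E" "distinct [a, b, c]"
  shows False
proof -
  have "is_cycle E [a, b, c]"
    using assms by (auto simp: is_cycle_def less_Suc_eq)
  from order_trans[OF assms(1) girth_le_length[OF this]] have "(5::enat) \<le> enat 3"
    by simp
  then show False by (simp add: numeral_eq_enat)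
qed

lemma no_quadrilateral:
  assumes "girth E \<ge> 5" "{a, b} \<in> E" "{b, c} \<in> E" "{c, d} \<in> E" "{d, a} \<in> E"
    "distinct [a, b, c, d]"
  shows False
proof -
  have "is_cycle E [a, b, c, d]"
    using assms by (auto simp: is_cycle_def less_Suc_eq)
  from order_trans[OF assms(1) girth_le_length[OF this]] have "(5::enat) \<le> enat 4"
    by simp
  then show False by (simp add: numeral_eq_enat)
qed

text \<open>There are as many cops as edges at \<open>v\<close>, so a placement covering these edges
  uses each cop exactly once.\<close>

lemma containing_placement_bij_betw:
  assumes "contained E (degree E v) p v"
  shows "bij_betw p {..<degree E v} (incident_edges E v)"
proof -
  have sub: "incident_edges E v \<subseteq> p ` {..<degree E v}"
    using assms by (simp add: contained_def occupied_def)
  have le: "card (p ` {..<degree E v}) \<le> card (incident_edges E v)"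
    using card_image_le[of "{..<degree E v}" p] by (simp add: degree_def)
  have eq: "incident_edges E v = p ` {..<degree E v}"
    using sub le by (intro card_seteq) auto
  then have "inj_on p {..<degree E v}"
    by (intro eq_card_imp_inj_on) (auto simp: degree_def)
  with eq show ?thesis by (simp add: bij_betw_def)
qed

text \<open>A cop who stays put also fits the last condition, since an edge is nonempty and so meets
  itself.\<close>

lemma threatenedE:
  assumes "threatened E (degree E v) p v" "\<And>i. i < degree E v \<Longrightarrow> p i \<in> E" "{} \<notin> E"
  obtains p' where "inj_on p' {..<degree E v}"
    "\<And>i. i < degree E v \<Longrightarrow> p' i \<in> E \<and> v \<in> p' i \<and> p i \<inter> p' i \<noteq> {}"
proof -
  obtain p' where step: "\<forall>i<degree E v. legal_cop_step E (p i) (p' i)"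
    and "contained E (degree E v) p' v"
    using assms(1) by (auto simp: threatened_def)
  then have bij: "bij_betw p' {..<degree E v} (incident_edges E v)"
    by (intro containing_placement_bij_betw)
  show thesis
  proof (rule that)
    show "inj_on p' {..<degree E v}" using bij by (rule bij_betw_imp_inj_on)
    fix i assume i: "i < degree E v"
    then have "p' i \<in> incident_edges E v"
      using bij by (auto simp: bij_betw_def)
    moreover have "p i \<inter> p' i \<noteq> {}"
      using step assms(2)[OF i] assms(3) i unfolding legal_cop_step_def by (metis Int_absorb)
    ultimately show "p' i \<in> E \<and> v \<in> p' i \<and> p i \<inter> p' i \<noteq> {}"
      by (simp add: incident_edges_def)
  qed
qed

lemma edge_eq_insert:
  assumes "finite_simple_graph V E" "e \<in> E" "v \<in> e"
  obtains x where "e = {v, x}" "x \<noteq> v"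
  using assms unfolding finite_simple_graph_def card_2_iff by fastforce

lemma edge_eq_doubleton:
  assumes "finite_simple_graph V E" "e \<in> E" "u \<in> e" "v \<in> e" "u \<noteq> v"
  shows "e = {u, v}"
  using edge_eq_insert[OF assms(1-3)] assms(4,5) by auto

text \<open>Otherwise \<open>e\<close> meets \<open>f\<close> and \<open>g\<close> in their far ends
  \<open>x\<close> and \<open>y\<close>. These close a triangle with \<open>u\<close> and
  \<open>v\<close> if they coincide, and a 4-cycle if they differ.\<close>

lemma edge_near_adjacent_vertices:
  assumes graph: "finite_simple_graph V E" and "girth E \<ge> 5"
    and uv: "{u, v} \<in> E" "u \<noteq> v"
    and e: "e \<in> E"
    and f: "f \<in> E" "v \<in> f" "e \<inter> f \<noteq> {}"
    and g: "g \<in> E" "u \<in> g" "e \<inter> g \<noteq> {}"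
  shows "u \<in> e \<or> v \<in> e"
proof (rule ccontr)
  assume not: "\<not> (u \<in> e \<or> v \<in> e)"
  obtain x where x: "f = {v, x}" "x \<noteq> v" using edge_eq_insert[OF graph f(1,2)] .
  obtain y where y: "g = {u, y}" "y \<noteq> u" using edge_eq_insert[OF graph g(1,2)] .
  have xe: "x \<in> e" and ye: "y \<in> e" using not x y f(3) g(3) by auto
  then have ne: "x \<noteq> u" "y \<noteq> v" using not by auto
  show False
  proof (cases "x = y")
    case True
    then show False
      using no_triangle[OF assms(2), of u v x] uv x y ne f(1) g(1) by (auto simp: insert_commute)
  next
    case False
    then have "e = {x, y}" using edge_eq_doubleton[OF graph e xe ye] by simp
    then show False
      using no_quadrilateral[OF assms(2), of u v x y] uv x y ne f(1) g(1) e False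
      by (auto simp: insert_commute)
  qed
qed

text \<open>If \<open>g\<close> met \<open>e\<close> in the far end of \<open>e\<close>, that vertex
  would form a triangle with \<open>u\<close> and \<open>v\<close>; hence they meet in
  \<open>v\<close>.\<close>

lemma edge_through_adjacent_vertices:
  assumes graph: "finite_simple_graph V E" and "girth E \<ge> 5"
    and uv: "{u, v} \<in> E" "u \<noteq> v"
    and e: "e \<in> E" "v \<in> e" "u \<notin> e"
    and g: "g \<in> E" "u \<in> g" "e \<inter> g \<noteq> {}"
  shows "g = {u, v}"
proof -
  obtain x where x: "e = {v, x}" "x \<noteq> v" using edge_eq_insert[OF graph e(1,2)] .
  obtain y where y: "g = {u, y}" "y \<noteq> u" using edge_eq_insert[OF graph g(1,2)] .
  have "x \<noteq> y"
    using no_triangle[OF assms(2), of u v x] uv x y e g by (auto simp: insert_commute)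
  then show ?thesis using x y e(3) g(3) by auto
qed

section \<open>Threats in regular graphs of girth at least five\<close>

locale regular_girth_five =
  fixes V :: "'a set" and E :: "'a set set" and \<delta> :: nat
  assumes degree_gt: "\<delta> > 2"
    and graph: "finite_simple_graph V E"
    and regular: "regular_graph V E \<delta>"
    and girth_ge: "girth E \<ge> 5"
begin

lemma degree_eq: "v \<in> V \<Longrightarrow> degree E v = \<delta>"
  using regular by (simp add: regular_graph_def)

lemma empty_not_edge: "{} \<notin> E"
  using graph by (auto simp: finite_simple_graph_def)

lemma edgeD: "{u, v} \<in> E \<Longrightarrow> u \<in> V \<and> v \<in> V \<and> u \<noteq> v"
  using graph by (force simp: finite_simple_graph_def)

text \<open>Both cops would have to move onto \<open>{u, v}\<close> to contain at \<open>u\<close>,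
  but a containing placement is injective.\<close>

lemma threatened_neighbour_cop_unique:
  assumes uv: "{u, v} \<in> E" and thr: "threatened E \<delta> p u" and cops: "\<And>i. i < \<delta> \<Longrightarrow> p i \<in> E"
    and i: "i < \<delta>" "v \<in> p i" "u \<notin> p i" and j: "j < \<delta>" "v \<in> p j" "u \<notin> p j"
  shows "i = j"
proof -
  have d: "degree E u = \<delta>" using edgeD[OF uv] degree_eq by blast
  obtain q where inj: "inj_on q {..<\<delta>}"
    and q: "\<And>i. i < \<delta> \<Longrightarrow> q i \<in> E \<and> u \<in> q i \<and> p i \<inter> q i \<noteq> {}"
    using threatenedE[of E u p] thr cops empty_not_edge unfolding d by blast
  have "q l = {u, v}" if "l < \<delta>" "v \<in> p l" "u \<notin> p l" for l
    using edge_through_adjacent_vertices[OF graph girth_ge uv _ cops[OF that(1)] that(2,3)]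
      q[OF that(1)] edgeD[OF uv] by blast
  with i j have "q i = q j" by simp
  with inj i j show ?thesis by (simp add: inj_on_eq_iff)
qed

lemma threatened_adjacent_cop_near:
  assumes uv: "{u, v} \<in> E" and thr: "threatened E \<delta> p u" "threatened E \<delta> p v"
    and cops: "\<And>i. i < \<delta> \<Longrightarrow> p i \<in> E" and i: "i < \<delta>"
  shows "u \<in> p i \<or> v \<in> p i"
proof -
  have d: "degree E u = \<delta>" "degree E v = \<delta>" using edgeD[OF uv] degree_eq by blast+
  obtain g where "g \<in> E" "u \<in> g" "p i \<inter> g \<noteq> {}"
    using threatenedE[of E u p] thr cops empty_not_edge i unfolding d by metis
  moreover obtain f where "f \<in> E" "v \<in> f" "p i \<inter> f \<noteq> {}"
    using threatenedE[of E v p] thr cops empty_not_edge i unfolding d by metis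
  ultimately show ?thesis
    using edge_near_adjacent_vertices[OF graph girth_ge uv _ cops[OF i]] edgeD[OF uv] by blast
qed

lemma both_threatened_imp_occupied:
  assumes uv: "{u, v} \<in> E" and thr: "threatened E \<delta> p u" "threatened E \<delta> p v"
    and cops: "\<And>i. i < \<delta> \<Longrightarrow> p i \<in> E"
  shows "{u, v} \<in> occupied \<delta> p"
proof (rule ccontr)
  assume free: "{u, v} \<notin> occupied \<delta> p"
  have not_both: "\<not> (u \<in> p i \<and> v \<in> p i)" if "i < \<delta>" for i
  proof
    assume "u \<in> p i \<and> v \<in> p i"
    then have "p i = {u, v}"
      using edge_eq_doubleton[OF graph cops[OF that], of u v] edgeD[OF uv] by blast
    then show False using free that by (auto simp: occupied_def)
  qed
  have vu: "{v, u} \<in> E" using uv by (simp add: insert_commute)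
  have near: "u \<in> p i \<or> v \<in> p i" if "i < \<delta>" for i
    by (rule threatened_adjacent_cop_near[OF uv thr cops that])
  \<comment> \<open>Each cop is at exactly one of \<open>u\<close> and \<open>v\<close>; uniqueness
    applied in both directions allows one cop per end.\<close>
  have same: "i = j" if "i < \<delta>" "j < \<delta>" "u \<in> p i \<longleftrightarrow> u \<in> p j" for i j
    using threatened_neighbour_cop_unique[OF uv thr(1) cops, of i j]
      threatened_neighbour_cop_unique[OF vu thr(2) cops, of i j]
      near not_both that by blast
  \<comment> \<open>Pigeonhole: three cops exist as \<open>\<delta>\<close> exceeds 2, but there are
    only two ends.\<close>
  have "(u \<in> p 0) \<noteq> (u \<in> p 1)" "(u \<in> p 0) \<noteq> (u \<in> p 2)" "(u \<in> p 1) \<noteq> (u \<in> p 2)"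
    using same[of 0 1] same[of 0 2] same[of 1 2] degree_gt by auto
  then show False by blast
qed

lemma exists_unthreatened_neighbour:
  assumes nc: "\<not> contained E \<delta> p v" and thr: "threatened E \<delta> p v"
    and cops: "\<And>i. i < \<delta> \<Longrightarrow> p i \<in> E"
  obtains u where "legal_robber_step E \<delta> p v u" "\<not> threatened E \<delta> p u"
proof -
  obtain e where e: "e \<in> E" "v \<in> e" "e \<notin> occupied \<delta> p"
    using nc by (auto simp: contained_def incident_edges_def)
  then obtain u where u: "e = {v, u}" using edge_eq_insert[OF graph] by metis
  show thesis
  proof (rule that)
    show "legal_robber_step E \<delta> p v u" using e u by (simp add: legal_robber_step_def)
    show "\<not> threatened E \<delta> p u"
      using both_threatened_imp_occupied[of v u p] thr cops e u by blast
  qed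
qed

lemma exists_unthreatened_vertex:
  assumes v: "v \<in> V" and cops: "\<And>i. i < \<delta> \<Longrightarrow> p i \<in> E"
  shows "\<exists>u\<in>V. \<not> threatened E \<delta> p u"
proof (rule ccontr)
  assume "\<not> ?thesis"
  then have thr: "threatened E \<delta> p u" if "u \<in> V" for u using that by blast
  have d: "degree E v = \<delta>" using v by (rule degree_eq)
  have "contained E \<delta> p v"
  proof (rule ccontr)
    assume "\<not> contained E \<delta> p v"
    then obtain u where "legal_robber_step E \<delta> p v u" "\<not> threatened E \<delta> p u"
      using exists_unthreatened_neighbour thr v cops by blast
    then show False using thr v edgeD by (auto simp: legal_robber_step_def)
  qed
  then have bij: "bij_betw p {..<\<delta>} (incident_edges E v)"
    using containing_placement_bij_betw[of E v p] d by simp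
  then have at_v: "v \<in> p i" if "i < \<delta>" for i
    using that by (auto simp: bij_betw_def incident_edges_def)
  \<comment> \<open>The neighbour is taken across the edge of cop 0, so that every other cop is at
    \<open>v\<close> but not at \<open>u\<close>.\<close>
  obtain u where u: "p 0 = {v, u}"
    using edge_eq_insert[OF graph, of "p 0" v] cops[of 0] at_v[of 0] degree_gt by auto
  then have uv: "{u, v} \<in> E" using cops[of 0] degree_gt by (simp add: insert_commute)
  have "u \<notin> p i" if "0 < i" "i < \<delta>" for i
  proof
    assume "u \<in> p i"
    then have "p i = p 0"
      using edge_eq_doubleton[OF graph cops[OF that(2)] at_v[OF that(2)], of u] edgeD[OF uv] u
      by blast
    then show False
      using inj_onD[OF bij_betw_imp_inj_on[OF bij], of i 0] that degree_gt by simp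
  qed
  \<comment> \<open>Cops 1 and 2 both stand at \<open>v\<close> off \<open>u\<close>, although
    \<open>u\<close> is threatened.\<close>
  then have "(1::nat) = 2"
    using threatened_neighbour_cop_unique[OF uv thr[of u] cops, of 1 2] edgeD[OF uv] at_v degree_gt
    by simp
  then show False by simp
qed

lemma not_winning_strategy:
  assumes "V \<noteq> {}"
  shows "\<not> winning_strategy V E \<delta> \<sigma>"
proof
  assume win: "winning_strategy V E \<delta> \<sigma>"
  have play: "legal_robber V E \<delta> \<sigma> (evasive_play E \<delta> \<sigma> v)" if "v \<in> V" for v
    using that by (rule legal_robber_evasive_play)
  \<comment> \<open>A winning strategy is legal only against legal robber plays, so some such play
    must be exhibited first; the initial placement is the same for all of them.\<close>
  have "\<sigma> [] i \<in> E" if "i < \<delta>" for i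
    using win play that assms unfolding winning_strategy_def legal_cops_def cops_at_def by fastforce
  then obtain v where v: "v \<in> V" "\<not> threatened E \<delta> (\<sigma> []) v"
    using exists_unthreatened_vertex assms by blast
  define r where "r = evasive_play E \<delta> \<sigma> v"
  have legal: "legal_robber V E \<delta> \<sigma> r" unfolding r_def using play v(1) .
  then have cops: "legal_cops E \<delta> \<sigma> r"
    and "\<exists>n. contained E \<delta> (cops_at \<sigma> r (Suc n)) (r n)"
    using win unfolding winning_strategy_def by blast+
  then obtain n where n: "contained E \<delta> (cops_at \<sigma> r (Suc n)) (r n)" by blast
  have step: "legal_cop_step E (cops_at \<sigma> r m i) (cops_at \<sigma> r (Suc m) i)" if "i < \<delta>" for m i
    using cops that by (simp add: legal_cops_def)
  have cop_edge: "cops_at \<sigma> r m i \<in> E" if "i < \<delta>" for m i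
  proof (induction m)
    case 0
    show ?case using cops that by (simp add: legal_cops_def)
  next
    case (Suc m)
    then show ?case using step[OF that, of m] by (auto simp: legal_cop_step_def)
  qed
  \<comment> \<open>Invariant at the moment before a cop turn: the robber at \<open>r m\<close>
    faces the placement after \<open>m\<close> turns, and no next move of the cops contains
    him.\<close>
  have "r m \<in> V \<and> \<not> threatened E \<delta> (cops_at \<sigma> r m) (r m)" for m
  proof (induction m)
    case 0
    show ?case using v by (simp add: r_def cops_at_def)
  next
    case (Suc m)
    let ?p = "cops_at \<sigma> r (Suc m)"
    have "\<not> contained E \<delta> ?p (r m)"
      using Suc step by (intro not_contained_if_not_threatened) auto
    moreover have "legal_robber_step E \<delta> ?p (r m) (r m)"
      by (simp add: legal_robber_step_def)
    ultimately obtain u where "legal_robber_step E \<delta> ?p (r m) u" "\<not> threatened E \<delta> ?p u"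
      using exists_unthreatened_neighbour[of ?p "r m"] Suc cop_edge by blast
    then have "\<not> threatened E \<delta> ?p (r (Suc m))"
      unfolding r_def evasive_play_Suc by (rule evasive_step_not_threatened)
    moreover have "r (Suc m) \<in> V"
      using legal Suc edgeD unfolding legal_robber_def legal_robber_step_def by metis
    ultimately show ?case by simp
  qed
  then have "\<not> contained E \<delta> (cops_at \<sigma> r (Suc n)) (r n)"
    using step by (intro not_contained_if_not_threatened) auto
  with n show False by contradiction
qed

end

theorem proposition3p6:
  fixes V :: "'a set" and E :: "'a set set" and \<delta> :: nat
  assumes "\<delta> > 2"
    and "finite_simple_graph V E"
    and "connected_graph V E"
    and "regular_graph V E \<delta>"
    and "girth E \<ge> 5"
  shows "\<not> containable V E"
proof -
  interpret regular_girth_five V E \<delta>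
    using assms by unfold_locales
  have nonempty: "V \<noteq> {}" using assms(3) by (simp add: connected_graph_def)
  then have "degree E ` V = {\<delta>}" using degree_eq by auto
  then have "max_degree V E = \<delta>" by (simp add: max_degree_def)
  then show ?thesis using not_winning_strategy[OF nonempty] by (simp add: containable_def)
qed

end
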